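(* Consider an iteration $k$ of the Curve Search method (described in the context). Let $x_k\in\Omega$, let $d_k$ satisfy $\nabla f(x_k)^\top d_k<0$ and $x_k+\alpha' d_k\in\Omega$ for all $\alpha'\in[0,1]$, and let $\gamma_k(t)=x_k+td_k+t^2(s_k-d_k)$ be the curve constructed in steps (2)-(5) of that iteration. Then the Armijo-type curve search in step (6), i.e. the computation of $$t_k=\max_{h\in\mathbb{N}}\{\delta^h \mid \gamma_k(\delta^h)\in\Omega \ \text{ and }\ f(\gamma_k(\delta^h))\le f(x_k)+\sigma\delta^h\nabla f(x_k)^\top d_k\}$$ by testing $h=0,1,2,\dots$ in order, terminates in a finite number of iterations returning a valid stepsize $t_k>0$. Moreover, one of the two following conditions holds: (i) $t_k=1$; (ii) $t_k<1$, and $\gamma_k\left(\frac{t_k}{\delta}\right)\notin\Omega$ or $f\left(\gamma_k\left(\frac{t_k}{\delta}\right)\right)>f(x_k)+\sigma\frac{t_k}{\delta}\nabla f(x_k)^\top d_k$.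
   Context: Problem: minimize $f(x)$ subject to $g(x)\le \mathbf{0}_m$, where $f:\mathbb{R}^n\to\mathbb{R}$ is continuously differentiable and $g=(g_1,\dots,g_m):\mathbb{R}^n\to\mathbb{R}^m$ is continuously differentiable with each $g_i$ convex. $\Omega=\{x\in\mathbb{R}^n\mid g(x)\le\mathbf{0}_m\}$ and $[m]=\{1,\dots,m\}$. Here $\mathbb{N}$ includes $0$. Curve Search method. Data: $x_0\in\Omega$, $\alpha,\beta>0$, $\tilde t\in(0,1)$, $\delta\in(0,1)$, $\sigma\in(0,1)$, and a decreasing sequence $\{\varepsilon_k\}\subseteq\mathbb{R}_+$. Set $x_{-1}=x_0$. For $k=0,1,2,\dots$, until a stopping criterion is satisfied: (1) compute a feasible gradient-related direction $d_k$ (in particular $\nabla f(x_k)^\top d_k<0$); (2) set $s_k=\alpha d_k+\beta(x_k-x_{k-1})$; (3) set $\tilde I_k=\{i\in[m]\mid g_i(x_k+\tilde t d_k)\ge-\varepsilon_k\}$; (4) if there is $i\in\tilde I_k$ with $g_i(x_k+s_k)>0$, or if $k=0$, reset $s_k=d_k$; (5) let $\gamma_k(t)=x_k+td_k+t^2(s_k-d_k)$, $t\in[0,1]$; (6) compute $t_k=\max_{h\in\mathbb{N}}\{\delta^h\mid\gamma_k(\delta^h)\in\Omega\ \text{and}\ f(\gamma_k(\delta^h))\le f(x_k)+\sigma\delta^h\nabla f(x_k)^\top d_k\}$; (7) set $x_{k+1}=\gamma_k(t_k)$. *)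

theory Defs
  imports "HOL-Analysis.Analysis" "HOL-Library.While_Combinator"
begin

definition continuously_differentiable ::
    "('a::real_normed_vector \<Rightarrow> 'b::real_normed_vector) \<Rightarrow> bool" where
  "continuously_differentiable f \<longleftrightarrow>
     (\<exists>f'. (\<forall>x. (f has_derivative blinfun_apply (f' x)) (at x)) \<and> continuous_on UNIV f')"

definition gradient :: "('a::real_inner \<Rightarrow> real) \<Rightarrow> 'a \<Rightarrow> 'a" where
  "gradient f x = (THE v. GDERIV f x :> v)"

(* The order on vectors is componentwise. *)
definition feasible_set :: "(real^'n \<Rightarrow> real^'m) \<Rightarrow> (real^'n) set" where
  "feasible_set g = {x. g x \<le> 0}"

definition feasible_direction :: "'a::real_vector set \<Rightarrow> 'a \<Rightarrow> 'a \<Rightarrow> bool" where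
  "feasible_direction S x d \<longleftrightarrow> (\<exists>a>0. \<forall>t\<in>{0..a}. x + t *\<^sub>R d \<in> S)"

definition almost_active ::
    "(real^'n \<Rightarrow> real^'m) \<Rightarrow> real \<Rightarrow> real \<Rightarrow> real^'n \<Rightarrow> real^'n \<Rightarrow> 'm set" where
  "almost_active g \<tau> e x d = {i. g (x + \<tau> *\<^sub>R d) $ i \<ge> - e}"

(* The convention x_{-1} = x_0. *)
definition previous :: "(nat \<Rightarrow> 'a) \<Rightarrow> nat \<Rightarrow> 'a" where
  "previous x k = (if k = 0 then x 0 else x (k - 1))"

definition momentum_step ::
    "real \<Rightarrow> real \<Rightarrow> (nat \<Rightarrow> real^'n) \<Rightarrow> (nat \<Rightarrow> real^'n) \<Rightarrow> nat \<Rightarrow> real^'n" where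
  "momentum_step \<alpha> \<beta> x d k = \<alpha> *\<^sub>R d k + \<beta> *\<^sub>R (x k - previous x k)"

(* s_k after the possible reset to d_k *)
definition search_step ::
    "(real^'n \<Rightarrow> real^'m) \<Rightarrow> real \<Rightarrow> real \<Rightarrow> real \<Rightarrow> (nat \<Rightarrow> real) \<Rightarrow>
     (nat \<Rightarrow> real^'n) \<Rightarrow> (nat \<Rightarrow> real^'n) \<Rightarrow> nat \<Rightarrow> real^'n" where
  "search_step g \<alpha> \<beta> \<tau> \<epsilon> x d k =
     (if (\<exists>i \<in> almost_active g \<tau> (\<epsilon> k) (x k) (d k).
            g (x k + momentum_step \<alpha> \<beta> x d k) $ i > 0) \<or> k = 0
      then d k else momentum_step \<alpha> \<beta> x d k)"

(* The curve is evaluated only on [0,1]. *)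
definition search_curve ::
    "(real^'n \<Rightarrow> real^'m) \<Rightarrow> real \<Rightarrow> real \<Rightarrow> real \<Rightarrow> (nat \<Rightarrow> real) \<Rightarrow>
     (nat \<Rightarrow> real^'n) \<Rightarrow> (nat \<Rightarrow> real^'n) \<Rightarrow> nat \<Rightarrow> real \<Rightarrow> real^'n" where
  "search_curve g \<alpha> \<beta> \<tau> \<epsilon> x d k t =
     x k + t *\<^sub>R d k + t\<^sup>2 *\<^sub>R (search_step g \<alpha> \<beta> \<tau> \<epsilon> x d k - d k)"

definition acceptable ::
    "(real^'n \<Rightarrow> real) \<Rightarrow> (real^'n) set \<Rightarrow> real \<Rightarrow> real^'n \<Rightarrow> real^'n \<Rightarrow>
     (real \<Rightarrow> real^'n) \<Rightarrow> real \<Rightarrow> bool" where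
  "acceptable f \<Omega> \<sigma> x d \<gamma> t \<longleftrightarrow>
     \<gamma> t \<in> \<Omega> \<and> f (\<gamma> t) \<le> f x + \<sigma> * t * (gradient f x \<bullet> d)"

(* The candidate set may be infinite, so Max cannot be used; the maximum is
   characterised as an element that is also an upper bound. *)
definition is_stepsize ::
    "(real^'n \<Rightarrow> real) \<Rightarrow> (real^'n) set \<Rightarrow> real \<Rightarrow> real \<Rightarrow> real^'n \<Rightarrow> real^'n \<Rightarrow>
     (real \<Rightarrow> real^'n) \<Rightarrow> real \<Rightarrow> bool" where
  "is_stepsize f \<Omega> \<sigma> \<delta> x d \<gamma> t \<longleftrightarrow>
     (let S = {\<delta> ^ h | h::nat. acceptable f \<Omega> \<sigma> x d \<gamma> (\<delta> ^ h)}
      in t \<in> S \<and> (\<forall>t'\<in>S. t' \<le> t))"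

(* The backtracking loop testing h = 0, 1, 2, ... in order; the result is None
   exactly if the loop does not terminate. *)
definition curve_search ::
    "(real^'n \<Rightarrow> real) \<Rightarrow> (real^'n) set \<Rightarrow> real \<Rightarrow> real \<Rightarrow> real^'n \<Rightarrow> real^'n \<Rightarrow>
     (real \<Rightarrow> real^'n) \<Rightarrow> real option" where
  "curve_search f \<Omega> \<sigma> \<delta> x d \<gamma> =
     map_option (\<lambda>h. \<delta> ^ h)
       (while_option (\<lambda>h. \<not> acceptable f \<Omega> \<sigma> x d \<gamma> (\<delta> ^ h)) Suc (0::nat))"

(* x 0, ..., x k are the iterates produced by iterations 0, ..., k - 1 of the
   method, with search directions d 0, ..., d (k - 1).  Gradient-relatedness
   enters only through the descent condition: beyond it, the notion concerns
   the asymptotics of an infinite run. *)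
definition generated_iterates ::
    "(real^'n \<Rightarrow> real) \<Rightarrow> (real^'n \<Rightarrow> real^'m) \<Rightarrow> real \<Rightarrow> real \<Rightarrow> real \<Rightarrow> real \<Rightarrow> real \<Rightarrow>
     (nat \<Rightarrow> real) \<Rightarrow> real^'n \<Rightarrow> (nat \<Rightarrow> real^'n) \<Rightarrow> (nat \<Rightarrow> real^'n) \<Rightarrow> nat \<Rightarrow> bool" where
  "generated_iterates f g \<alpha> \<beta> \<tau> \<delta> \<sigma> \<epsilon> x0 x d k \<longleftrightarrow>
     x 0 = x0 \<and>
     (\<forall>j<k. feasible_direction (feasible_set g) (x j) (d j) \<and>
            gradient f (x j) \<bullet> d j < 0 \<and>
            (\<exists>t. is_stepsize f (feasible_set g) \<sigma> \<delta> (x j) (d j)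
                    (search_curve g \<alpha> \<beta> \<tau> \<epsilon> x d j) t \<and>
                 x (Suc j) = search_curve g \<alpha> \<beta> \<tau> \<epsilon> x d j t))"

end

theory Submission
  imports Defs
begin

text \<open>
  The backtracking loop stops as soon as it meets a power \<open>\<delta> ^ h\<close> that is acceptable, so termination
  follows once every sufficiently small \<open>t > 0\<close> is acceptable; that the loop stopped
  no earlier gives maximality and the failure of the preceding trial value \<open>t / \<delta>\<close>.

  Sufficient decrease for small \<open>t\<close> is the usual Armijo argument: the quadratic term of the curve
  does not affect its velocity \<open>d\<close> at \<open>0\<close>, so \<open>f\<close> along the curve has slope
  \<open>gradient f x \<bullet> d\<close>, which is strictly below \<open>\<sigma>\<close> times itself because it is negative.

  Feasibility for small \<open>t\<close> is checked constraint by constraint, each time by writing the curve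
  point as a convex combination of points where the constraint holds. If the constraint
  holds at \<open>x + s\<close>, the curve point lies in the triangle with vertices \<open>x\<close>, \<open>x + d\<close>, \<open>x + s\<close>
  (\<open>quadratic_curve_in_sublevel\<close>). Otherwise the construction of \<open>s\<close> ensures that the constraint
  is strictly satisfied at \<open>x + \<tau> d\<close>; the curve point then lies on the segment from \<open>x\<close> to a
  point that tends to \<open>x + \<tau> d\<close> as \<open>t\<close> tends to \<open>0\<close>
  (\<open>quadratic_curve_eventually_in_sublevel\<close>).
\<close>

lemma gradient_has_derivative:
  fixes f :: "real^'n \<Rightarrow> real"
  assumes "f differentiable (at x)"
  shows "(f has_derivative (\<lambda>h. h \<bullet> gradient f x)) (at x)"
proof -
  obtain f' where f': "(f has_derivative f') (at x)"
    using assms by (auto simp: differentiable_def)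
  then have "f' = (\<lambda>h. h \<bullet> adjoint f' 1)"
    using adjoint_works[OF has_derivative_linear[OF f'], of _ 1] by auto
  with f' have ex: "GDERIV f x :> adjoint f' 1"
    by (simp add: gderiv_def)
  have unique: "v = adjoint f' 1" if "GDERIV f x :> v" for v
  proof -
    have "(\<lambda>h. h \<bullet> v) = (\<lambda>h. h \<bullet> adjoint f' 1)"
      using that ex has_derivative_unique unfolding gderiv_def by blast
    then show ?thesis
      by (metis vector_eq_ldot)
  qed
  have "GDERIV f x :> gradient f x"
    unfolding gradient_def using ex unique by (rule theI)
  then show ?thesis
    by (simp add: gderiv_def)
qed

lemma convex_sublevel:
  fixes q :: "'a::real_vector \<Rightarrow> real"
  assumes "convex_on UNIV q"
  shows "convex {y. q y \<le> c}"
proof (rule convexI)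
  fix y z and u v :: real
  assume *: "y \<in> {y. q y \<le> c}" "z \<in> {y. q y \<le> c}" "0 \<le> u" "0 \<le> v" "u + v = 1"
  then have "q (u *\<^sub>R y + v *\<^sub>R z) \<le> u * q y + v * q z"
    using assms by (simp add: convex_on_def)
  also have "\<dots> \<le> c"
    using * by (intro convex_bound_le) auto
  finally show "u *\<^sub>R y + v *\<^sub>R z \<in> {y. q y \<le> c}"
    by simp
qed

lemma quadratic_curve_in_sublevel:
  fixes q :: "'a::real_vector \<Rightarrow> real"
  assumes "convex_on UNIV q" "q x \<le> 0" "q (x + d) \<le> 0" "q (x + s) \<le> 0" "0 \<le> t" "t \<le> 1"
  shows "q (x + t *\<^sub>R d + t\<^sup>2 *\<^sub>R (s - d)) \<le> 0"
proof -
  have conv: "convex {y. q y \<le> 0}"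
    using assms(1) by (rule convex_sublevel)
  let ?y = "(1 - t) *\<^sub>R (x + d) + t *\<^sub>R (x + s)"
  have "?y \<in> {y. q y \<le> 0}"
    by (rule convexD[OF conv]) (use assms in auto)
  then have "(1 - t) *\<^sub>R x + t *\<^sub>R ?y \<in> {y. q y \<le> 0}"
    by (intro convexD[OF conv]) (use assms in auto)
  moreover have "(1 - t) *\<^sub>R x + t *\<^sub>R ?y = x + t *\<^sub>R d + t\<^sup>2 *\<^sub>R (s - d)"
    by (simp add: algebra_simps power2_eq_square)
  ultimately show ?thesis
    by simp
qed

text \<open>
  Strictness at \<open>x + \<tau> d\<close> absorbs the bending term: dividing the displacement by \<open>t / \<tau>\<close> turns the
  curve point into \<open>x + \<tau> d + t \<tau> (s - d)\<close>, where continuity keeps \<open>q\<close> negative, whatever \<open>s\<close> is.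
\<close>

lemma quadratic_curve_eventually_in_sublevel:
  fixes q :: "'a::real_normed_vector \<Rightarrow> real"
  assumes "convex_on UNIV q" "isCont q (x + \<tau> *\<^sub>R d)"
    and "q x \<le> 0" "q (x + \<tau> *\<^sub>R d) < 0" "0 < \<tau>"
  shows "\<forall>\<^sub>F t in at_right 0. q (x + t *\<^sub>R d + t\<^sup>2 *\<^sub>R (s - d)) \<le> 0"
proof -
  let ?z = "\<lambda>t. x + \<tau> *\<^sub>R d + (t * \<tau>) *\<^sub>R (s - d)"
  have "(?z \<longlongrightarrow> ?z 0) (at_right 0)"
    by (intro tendsto_intros)
  then have "((\<lambda>t. q (?z t)) \<longlongrightarrow> q (x + \<tau> *\<^sub>R d)) (at_right 0)"
    using assms(2) by (intro isCont_tendsto_compose[of _ q]) auto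
  then have "\<forall>\<^sub>F t in at_right 0. q (?z t) < 0"
    using assms(4) by (rule order_tendstoD)
  moreover have "\<forall>\<^sub>F t in at_right 0. t \<in> {0<..<\<tau>}"
    using assms(5) by (rule eventually_at_right_real)
  ultimately show ?thesis
  proof eventually_elim
    case (elim t)
    have conv: "convex {y. q y \<le> 0}"
      using assms(1) by (rule convex_sublevel)
    have "(1 - t / \<tau>) *\<^sub>R x + (t / \<tau>) *\<^sub>R ?z t \<in> {y. q y \<le> 0}"
      by (rule convexD[OF conv]) (use assms elim in auto)
    moreover have "(1 - t / \<tau>) *\<^sub>R x + (t / \<tau>) *\<^sub>R ?z t = x + t *\<^sub>R d + t\<^sup>2 *\<^sub>R (s - d)"
      using assms(5) by (simp add: algebra_simps power2_eq_square)
    ultimately show ?case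
      by simp
  qed
qed

lemma armijo_eventually_along_quadratic_curve:
  fixes f :: "real^'n \<Rightarrow> real"
  assumes "f differentiable (at x)" "gradient f x \<bullet> d < 0" "\<sigma> < 1"
  shows "\<forall>\<^sub>F t in at_right 0.
           f (x + t *\<^sub>R d + t\<^sup>2 *\<^sub>R (s - d)) \<le> f x + \<sigma> * t * (gradient f x \<bullet> d)"
proof -
  let ?\<gamma> = "\<lambda>t. x + t *\<^sub>R d + t\<^sup>2 *\<^sub>R (s - d)"
  let ?D = "gradient f x \<bullet> d"
  have "(?\<gamma> has_vector_derivative d) (at 0)"
    by (auto intro!: derivative_eq_intros)
  then have curve: "(?\<gamma> has_derivative (\<lambda>h. h *\<^sub>R d)) (at 0)"
    by (simp add: has_vector_derivative_def)
  have "((\<lambda>t. f (?\<gamma> t)) has_derivative (\<lambda>h. (h *\<^sub>R d) \<bullet> gradient f x)) (at 0)"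
    using has_derivative_compose[OF curve, of f "\<lambda>h. h \<bullet> gradient f x"]
      gradient_has_derivative[OF assms(1)] by simp
  then have "((\<lambda>t. f (?\<gamma> t)) has_real_derivative ?D) (at 0)"
    by (simp add: has_field_derivative_def inner_commute mult_commute_abs)
  then have "((\<lambda>t. f (?\<gamma> t) - \<sigma> * t * ?D) has_real_derivative ?D - \<sigma> * ?D) (at 0)"
    by (auto intro!: derivative_eq_intros)
  moreover have "?D - \<sigma> * ?D < 0"
    using mult_pos_neg[of "1 - \<sigma>" ?D] assms by (simp add: algebra_simps)
  ultimately obtain e where "e > 0"
    and e: "\<And>h. 0 < h \<Longrightarrow> h < e \<Longrightarrow> f (?\<gamma> (0 + h)) - \<sigma> * (0 + h) * ?D < f (?\<gamma> 0) - \<sigma> * 0 * ?D"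
    using DERIV_neg_dec_right by blast
  have "\<forall>\<^sub>F t in at_right 0. t \<in> {0<..<e}"
    using \<open>e > 0\<close> by (rule eventually_at_right_real)
  then show ?thesis
    by eventually_elim (use e in fastforce)
qed

lemma continuously_differentiable_imp_differentiable:
  "continuously_differentiable f \<Longrightarrow> f differentiable (at x)"
  by (auto simp: continuously_differentiable_def differentiable_def)

text \<open>
  The loop returns the power at the least acceptable exponent \<open>h\<close>. This is the largest acceptable
  power because powers of \<open>\<delta>\<close> decrease, and for \<open>h > 0\<close> the value \<open>\<delta> ^ h / \<delta>\<close> is the last rejected
  trial.
\<close>

lemma curve_search_eq_Some:
  assumes "0 < \<delta>" "\<delta> < 1" "acceptable f \<Omega> \<sigma> x d \<gamma> (\<delta> ^ h)"
  shows "\<exists>t. curve_search f \<Omega> \<sigma> \<delta> x d \<gamma> = Some t \<and> is_stepsize f \<Omega> \<sigma> \<delta> x d \<gamma> t \<and> t > 0 \<and>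
             (t = 1 \<or> t < 1 \<and> \<not> acceptable f \<Omega> \<sigma> x d \<gamma> (t / \<delta>))"
proof -
  let ?P = "\<lambda>h. acceptable f \<Omega> \<sigma> x d \<gamma> (\<delta> ^ h)"
  let ?m = "LEAST h. ?P h"
  have iter: "(Suc ^^ j) 0 = j" for j :: nat
    by (induction j) auto
  have least: "?P ?m"
    using assms(3) by (rule LeastI)
  then have "while_option (\<lambda>h. \<not> ?P h) Suc 0 = Some ?m"
    by (auto simp: while_option_def iter)
  then have search: "curve_search f \<Omega> \<sigma> \<delta> x d \<gamma> = Some (\<delta> ^ ?m)"
    by (simp add: curve_search_def)
  have "\<delta> ^ j \<le> \<delta> ^ ?m" if "?P j" for j
    using assms(1,2) Least_le[of ?P, OF that] by (intro power_decreasing) auto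
  then have max: "is_stepsize f \<Omega> \<sigma> \<delta> x d \<gamma> (\<delta> ^ ?m)"
    using least by (auto simp: is_stepsize_def Let_def)
  have prev: "\<delta> ^ ?m = 1 \<or> \<delta> ^ ?m < 1 \<and> \<not> acceptable f \<Omega> \<sigma> x d \<gamma> (\<delta> ^ ?m / \<delta>)"
  proof (cases ?m)
    case 0
    then show ?thesis by simp
  next
    case (Suc n)
    then have "\<not> ?P n"
      using not_less_Least[of n ?P] by simp
    moreover have "\<delta> ^ ?m / \<delta> = \<delta> ^ n"
      using assms(1) Suc by simp
    moreover have "\<delta> ^ ?m < 1"
      using assms(1,2) Suc power_Suc_less_one[of \<delta> n] by simp
    ultimately show ?thesis
      by simp
  qed
  show ?thesis
    using search max prev assms(1) by (intro exI[of _ "\<delta> ^ ?m"]) auto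
qed

theorem proposition3p5:
  fixes f :: "real^'n \<Rightarrow> real" and g :: "real^'n \<Rightarrow> real^'m"
    and \<alpha> \<beta> \<tau> \<delta> \<sigma> :: real and \<epsilon> :: "nat \<Rightarrow> real"
    and x0 :: "real^'n" and x d :: "nat \<Rightarrow> real^'n" and k :: nat
    and \<Omega> :: "(real^'n) set" and \<gamma> :: "real \<Rightarrow> real^'n"
  assumes "continuously_differentiable f"
    and "continuously_differentiable g"
    and "\<And>i. convex_on UNIV (\<lambda>y. g y $ i)"
    and "\<Omega> = feasible_set g"
    and "x0 \<in> \<Omega>"
    and "\<alpha> > 0" and "\<beta> > 0"
    and "0 < \<tau>" and "\<tau> < 1"
    and "0 < \<delta>" and "\<delta> < 1"
    and "0 < \<sigma>" and "\<sigma> < 1"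
    and "decseq \<epsilon>" and "\<And>j. \<epsilon> j \<ge> 0"
    and "generated_iterates f g \<alpha> \<beta> \<tau> \<delta> \<sigma> \<epsilon> x0 x d k"
    and "x k \<in> \<Omega>"
    and "gradient f (x k) \<bullet> d k < 0"
    and "\<And>a. 0 \<le> a \<Longrightarrow> a \<le> 1 \<Longrightarrow> x k + a *\<^sub>R d k \<in> \<Omega>"
    and "\<gamma> = search_curve g \<alpha> \<beta> \<tau> \<epsilon> x d k"
  shows "\<exists>t. curve_search f \<Omega> \<sigma> \<delta> (x k) (d k) \<gamma> = Some t \<and>
             is_stepsize f \<Omega> \<sigma> \<delta> (x k) (d k) \<gamma> t \<and> t > 0 \<and>
             (t = 1 \<or>
              t < 1 \<and> (\<gamma> (t / \<delta>) \<notin> \<Omega> \<or>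
                f (\<gamma> (t / \<delta>)) > f (x k) + \<sigma> * (t / \<delta>) * (gradient f (x k) \<bullet> d k)))"
proof -
  define s where "s = search_step g \<alpha> \<beta> \<tau> \<epsilon> x d k"
  note convg = assms(3)
  have \<gamma>: "\<gamma> t = x k + t *\<^sub>R d k + t\<^sup>2 *\<^sub>R (s - d k)" for t
    using assms(20) by (simp add: search_curve_def s_def)
  have feasible: "g (x k + a *\<^sub>R d k) $ i \<le> 0" if "0 \<le> a" "a \<le> 1" for a i
    using assms(19)[OF that] assms(4) by (simp add: feasible_set_def less_eq_vec_def)
  have feasible0: "g (x k) $ i \<le> 0" and feasible1: "g (x k + d k) $ i \<le> 0" for i
    using feasible[of 0 i] feasible[of 1 i] by auto
  have contg: "isCont (\<lambda>y. g y $ i) z" for i z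
    using continuously_differentiable_imp_differentiable[OF assms(2)]
    by (intro continuous_intros differentiable_imp_continuous_within)
  \<comment> \<open>A constraint that is not almost active lies below \<open>- \<epsilon> k \<le> 0\<close> at the trial point. The almost
    active ones hold at \<open>x k + s\<close>, since any violation resets \<open>s\<close> to the feasible step \<open>d k\<close>.\<close>
  have dichotomy: "g (x k + s) $ i \<le> 0 \<or> g (x k + \<tau> *\<^sub>R d k) $ i < 0" for i
    using assms(15)[of k] feasible1[of i]
    by (force simp: s_def search_step_def almost_active_def not_less not_le)
  have "\<forall>\<^sub>F t in at_right 0. g (\<gamma> t) $ i \<le> 0" for i
  proof (cases "g (x k + s) $ i \<le> 0")
    case True
    have "\<forall>\<^sub>F t in at_right (0::real). t \<in> {0<..<1}"
      by (rule eventually_at_right_real) simp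
    then show ?thesis
    proof eventually_elim
      case (elim t)
      then show ?case
        unfolding \<gamma>
        by (intro quadratic_curve_in_sublevel[OF convg feasible0 feasible1 True]) auto
    qed
  next
    case False
    then show ?thesis
      unfolding \<gamma> using dichotomy[of i] assms(8)
      by (intro quadratic_curve_eventually_in_sublevel[OF convg contg feasible0]) auto
  qed
  then have "\<forall>\<^sub>F t in at_right 0. \<forall>i. g (\<gamma> t) $ i \<le> 0"
    by (rule eventually_all_finite)
  moreover have "\<forall>\<^sub>F t in at_right 0. f (\<gamma> t) \<le> f (x k) + \<sigma> * t * (gradient f (x k) \<bullet> d k)"
    unfolding \<gamma> using continuously_differentiable_imp_differentiable[OF assms(1)] assms(18,13)
    by (rule armijo_eventually_along_quadratic_curve)
  ultimately have "\<forall>\<^sub>F t in at_right 0. acceptable f \<Omega> \<sigma> (x k) (d k) \<gamma> t"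
    by eventually_elim (simp add: acceptable_def assms(4) feasible_set_def less_eq_vec_def)
  moreover have "filterlim (\<lambda>h. \<delta> ^ h) (at_right 0) sequentially"
    using assms(10,11) LIMSEQ_power_zero[of \<delta>]
    by (auto simp: filterlim_at)
  ultimately have "\<forall>\<^sub>F h in sequentially. acceptable f \<Omega> \<sigma> (x k) (d k) \<gamma> (\<delta> ^ h)"
    by (rule eventually_compose_filterlim)
  then obtain h where "acceptable f \<Omega> \<sigma> (x k) (d k) \<gamma> (\<delta> ^ h)"
    by (auto simp: eventually_sequentially)
  from curve_search_eq_Some[OF assms(10,11) this] show ?thesis
    by (auto simp: acceptable_def not_le)
qed

end
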